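(* Let $k$ and $d$ be integers with $1\le k\le d$, and let $K$ be a set of $k$ positive integers. Then $$n(K,d)\le 2^k\binom{d}{k}+\sum_{i=1}^{k-1}2^i\binom{d-1}{i-1}.$$
   Context: All graphs are finite and simple. A biclique of a graph $G$ is a complete bipartite subgraph of $G$; it is given by two disjoint vertex classes $X,Y\subseteq V(G)$ such that every vertex of $X$ is adjacent in $G$ to every vertex of $Y$, its edges being all pairs $xy$ with $x\in X$, $y\in Y$ (a class may be empty). A biclique cover of $G$ is a collection (indexed family, repetitions allowed) of bicliques of $G$ such that every edge of $G$ belongs to at least one of them; the number of bicliques in the collection is its size. For a set $K$ of positive integers, a biclique cover of $G$ is of type $K$ if for every edge $e$ of $G$ the number of bicliques of the cover that contain $e$ is an element of $K$. The number $n(K,d)$ is the maximum number $n$ of vertices of a complete graph $K_n$ that admits a biclique cover of type $K$ and size $d$. *)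

theory Defs
  imports Main
begin

type_synonym 'a graph = "'a set \<times> 'a set set"

definition verts :: "'a graph \<Rightarrow> 'a set" where
  "verts G = fst G"

definition edges :: "'a graph \<Rightarrow> 'a set set" where
  "edges G = snd G"

definition simple_graph :: "'a graph \<Rightarrow> bool" where
  "simple_graph G \<longleftrightarrow> finite (verts G) \<and> (\<forall>e \<in> edges G. e \<subseteq> verts G \<and> card e = 2)"

definition complete_graph :: "nat \<Rightarrow> nat graph" where
  "complete_graph n = ({..<n}, {e. e \<subseteq> {..<n} \<and> card e = 2})"

text \<open>A biclique is identified with its pair of vertex classes, either of which may be empty.\<close>

definition is_biclique :: "'a graph \<Rightarrow> 'a set \<times> 'a set \<Rightarrow> bool" where
  "is_biclique G B \<longleftrightarrow>
     fst B \<subseteq> verts G \<and> snd B \<subseteq> verts G \<and> fst B \<inter> snd B = {} \<and>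
     (\<forall>x \<in> fst B. \<forall>y \<in> snd B. {x, y} \<in> edges G)"

definition biclique_edges :: "'a set \<times> 'a set \<Rightarrow> 'a set set" where
  "biclique_edges B = {{x, y} | x y. x \<in> fst B \<and> y \<in> snd B}"

text \<open>A collection of size \<open>d\<close> is the family \<open>B 0, \<dots>, B (d - 1)\<close>, repetitions allowed;
  the values of \<open>B\<close> at indices \<open>\<ge> d\<close> are irrelevant.\<close>

definition biclique_cover :: "'a graph \<Rightarrow> nat \<Rightarrow> (nat \<Rightarrow> 'a set \<times> 'a set) \<Rightarrow> bool" where
  "biclique_cover G d B \<longleftrightarrow>
     (\<forall>i<d. is_biclique G (B i)) \<and> (\<forall>e \<in> edges G. \<exists>i<d. e \<in> biclique_edges (B i))"

definition biclique_cover_of_type ::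
    "nat set \<Rightarrow> 'a graph \<Rightarrow> nat \<Rightarrow> (nat \<Rightarrow> 'a set \<times> 'a set) \<Rightarrow> bool" where
  "biclique_cover_of_type K G d B \<longleftrightarrow>
     biclique_cover G d B \<and> (\<forall>e \<in> edges G. card {i. i < d \<and> e \<in> biclique_edges (B i)} \<in> K)"

definition coverable_orders :: "nat set \<Rightarrow> nat \<Rightarrow> nat set" where
  "coverable_orders K d = {n. \<exists>B. biclique_cover_of_type K (complete_graph n) d B}"

definition max_order :: "nat set \<Rightarrow> nat \<Rightarrow> nat" where
  "max_order K d = Max (coverable_orders K d)"

lemma simple_graph_complete_graph: "simple_graph (complete_graph n)"
  by (simp add: simple_graph_def complete_graph_def verts_def edges_def)

text \<open>The maximum is taken over a finite set that always contains \<open>1\<close>.\<close>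

lemma coverable_orders_le:
  assumes "n \<in> coverable_orders K d"
  shows "n \<le> 2 ^ d"
proof -
  obtain B where B: "biclique_cover (complete_graph n) d B"
    using assms by (auto simp: coverable_orders_def biclique_cover_of_type_def)
  define f where "f v = {i. i < d \<and> v \<in> fst (B i)}" for v
  have "inj_on f {..<n}"
  proof (rule inj_onI, rule ccontr)
    fix u v assume uv: "u \<in> {..<n}" "v \<in> {..<n}" "f u = f v" "u \<noteq> v"
    then have "{u, v} \<in> edges (complete_graph n)"
      by (auto simp: complete_graph_def edges_def)
    then obtain i where i: "i < d" "{u, v} \<in> biclique_edges (B i)"
      using B unfolding biclique_cover_def by blast
    have disj: "fst (B i) \<inter> snd (B i) = {}"
      using B i(1) unfolding biclique_cover_def is_biclique_def by blast
    have "u \<in> fst (B i) \<and> v \<in> snd (B i) \<or> v \<in> fst (B i) \<and> u \<in> snd (B i)"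
      using i(2) by (auto simp: biclique_edges_def doubleton_eq_iff)
    moreover have "u \<in> fst (B i) \<longleftrightarrow> v \<in> fst (B i)"
      using uv(3) i(1) by (auto simp: f_def)
    ultimately show False using disj by blast
  qed
  moreover have "f ` {..<n} \<subseteq> Pow {..<d}" by (auto simp: f_def)
  ultimately have "card {..<n} \<le> card (Pow {..<d})"
    by (intro card_inj_on_le) auto
  then show ?thesis by (simp add: card_Pow)
qed

lemma finite_coverable_orders: "finite (coverable_orders K d)"
  by (rule finite_subset[of _ "{..2 ^ d}"]) (auto dest: coverable_orders_le)

lemma one_in_coverable_orders: "1 \<in> coverable_orders K d"
proof -
  have no_edges: "edges (complete_graph 1) = {}"
  proof -
    have "card e \<noteq> 2" if "e \<subseteq> {..<1::nat}" for e
      using card_mono[OF _ that] by simp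
    then show ?thesis by (auto simp: complete_graph_def edges_def)
  qed
  then have "biclique_cover_of_type K (complete_graph 1) d (\<lambda>_. ({}, {}))"
    by (simp add: biclique_cover_of_type_def biclique_cover_def is_biclique_def)
  then show ?thesis unfolding coverable_orders_def by blast
qed

end

theory Submission
  imports Defs Complex_Main
begin

text \<open>The proof extends the argument of Witsenhausen and Tverberg for the Graham--Pollak theorem.
  Record a vertex by the set of literals \<open>(i, b)\<close>, where \<open>b\<close> tells in which class of the \<open>i\<close>-th biclique
  the vertex lies. An edge \<open>uv\<close> lies in exactly \<open>t = |W u \<inter> flip (W v)|\<close> bicliques, where \<open>W\<close> gives the
  literal sets and \<open>flip\<close> exchanges the two classes of each biclique. The polynomial
  \<open>f(t) = (\<Prod>j\<in>K. j - t)\<close> therefore vanishes for every pair \<open>u \<noteq> v\<close>, and it equals \<open>\<Prod>K \<noteq> 0\<close> for \<open>u = v\<close>.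

  Write \<open>f(t) = (\<Sum>s\<le>k. b s * (t choose s))\<close>. Since \<open>t choose s\<close> counts the literal sets \<open>S\<close> of size \<open>s\<close>
  with \<open>S \<subseteq> W u\<close> and \<open>flip S \<subseteq> W v\<close>, every weighting \<open>c\<close> of the vertices satisfies
  \<open>\<Prod>K * (\<Sum>v. c v ^ 2) = (\<Sum>S. b |S| * L S * L (flip S))\<close>, where \<open>L S\<close> is the total weight
  of the vertices with \<open>S \<subseteq> W v\<close>, and \<open>S\<close> ranges over the sets of at most \<open>k\<close> literals that contain no
  two literals with the same index. If \<open>L\<close> vanishes on the empty set and on one member of each pair
  \<open>{S, flip S}\<close>, then the right-hand side is \<open>0\<close>, so \<open>c = 0\<close>. Hence the number of these linear
  conditions bounds the number of vertices:
  \<open>n \<le> 1 + (\<Sum>s=1..k. 2^(s-1) * (d choose s))\<close>. An induction on \<open>k\<close> with Pascal's rule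
  shows that this is at most the bound claimed.\<close>

section \<open>Homogeneous linear systems\<close>

text \<open>This is Gaussian elimination: an unknown \<open>p\<close> with a nonzero coefficient in one equation is
  expressed by the others, which leaves a system with one equation and one unknown fewer.\<close>

lemma exists_nontrivial_solution:
  fixes a :: "'i \<Rightarrow> 'v \<Rightarrow> 'f::field"
  assumes "finite I" "finite V" "card I < card V"
  shows "\<exists>c. (\<exists>v\<in>V. c v \<noteq> 0) \<and> (\<forall>i\<in>I. (\<Sum>v\<in>V. c v * a i v) = 0)"
  using assms
proof (induction I arbitrary: V a rule: finite_induct)
  case empty
  then have "V \<noteq> {}" by auto
  then show ?case by (intro exI[of _ "\<lambda>_. 1"]) auto
next
  case (insert j I)
  show ?case
  proof (cases "\<forall>v\<in>V. a j v = 0")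
    case True
    have "card I < card V" using insert by simp
    then obtain c where "\<exists>v\<in>V. c v \<noteq> 0" "\<forall>i\<in>I. (\<Sum>v\<in>V. c v * a i v) = 0"
      using insert.IH[of V a] insert.prems by blast
    with True show ?thesis by (intro exI[of _ c]) simp
  next
    case False
    then obtain p where p: "p \<in> V" "a j p \<noteq> 0" by blast
    define a' where "a' i v = a i v - a i p * a j v / a j p" for i v
    have "card I < card (V - {p})" using insert p by simp
    then obtain c where c: "\<exists>v\<in>V - {p}. c v \<noteq> 0"
        "\<forall>i\<in>I. (\<Sum>v\<in>V - {p}. c v * a' i v) = 0"
      using insert.IH[of "V - {p}" a'] insert.prems by auto
    define q where "q = - (\<Sum>v\<in>V - {p}. c v * a j v) / a j p"
    define c' where "c' = c(p := q)"
    have split: "(\<Sum>v\<in>V. c' v * a i v) = q * a i p + (\<Sum>v\<in>V - {p}. c v * a i v)" for i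
      using insert.prems p
      by (subst sum.remove[of _ p]) (auto simp: c'_def intro!: sum.cong)
    have "(\<Sum>v\<in>V. c' v * a j v) = 0"
      unfolding split using p by (simp add: q_def)
    moreover have "(\<Sum>v\<in>V. c' v * a i v) = 0" if "i \<in> I" for i
    proof -
      have "(\<Sum>v\<in>V - {p}. c v * a' i v)
          = (\<Sum>v\<in>V - {p}. c v * a i v) - a i p / a j p * (\<Sum>v\<in>V - {p}. c v * a j v)"
        by (simp add: a'_def right_diff_distrib sum_subtractf sum_distrib_left mult_ac)
      also have "\<dots> = (\<Sum>v\<in>V. c' v * a i v)"
        unfolding split using p by (simp add: q_def)
      finally show ?thesis using c(2) that by simp
    qed
    moreover have "\<exists>v\<in>V. c' v \<noteq> 0" using c(1) by (auto simp: c'_def)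
    ultimately show ?thesis by blast
  qed
qed

section \<open>The Newton expansion of a product of linear factors\<close>

text \<open>A further factor raises the degree by one because of the identity
  \<open>(j - t) * (t choose s) = (j - s) * (t choose s) - (s + 1) * (t choose (s + 1))\<close>.\<close>

lemma prod_roots_binomial_expansion:
  fixes K :: "nat set"
  assumes "finite K"
  shows "\<exists>b :: nat \<Rightarrow> real. \<forall>t. (\<Prod>j\<in>K. real j - real t) = (\<Sum>s\<le>card K. b s * real (t choose s))"
  using assms
proof (induction K rule: finite_induct)
  case empty
  show ?case by (intro exI[of _ "\<lambda>_. 1"]) simp
next
  case (insert j K)
  then obtain b :: "nat \<Rightarrow> real"
    where b: "\<And>t. (\<Prod>j\<in>K. real j - real t) = (\<Sum>s\<le>card K. b s * real (t choose s))" by blast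
  define b' where "b' s = (if s \<le> card K then (real j - real s) * b s else 0)
      - (if s = 0 then 0 else real s * b (s - 1))" for s
  have step: "(real j - real t) * real (t choose s)
      = (real j - real s) * real (t choose s) - real (Suc s) * real (t choose Suc s)" for t s
  proof -
    have "Suc s * (t choose Suc s) + s * (t choose s) = t * (t choose s)"
      using Suc_times_binomial_eq[of t s] by (simp add: algebra_simps)
    then have "real (Suc s) * real (t choose Suc s) + real s * real (t choose s)
        = real t * real (t choose s)"
      by (metis of_nat_add of_nat_mult)
    then show ?thesis by (simp add: algebra_simps)
  qed
  have "(\<Prod>j\<in>insert j K. real j - real t) = (\<Sum>s\<le>Suc (card K). b' s * real (t choose s))" for t
  proof -
    have "(\<Prod>j\<in>insert j K. real j - real t)
        = (\<Sum>s\<le>card K. b s * ((real j - real t) * real (t choose s)))"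
      using insert by (simp add: b sum_distrib_left mult_ac)
    also have "\<dots> = (\<Sum>s\<le>card K. (real j - real s) * b s * real (t choose s))
        - (\<Sum>s\<le>card K. real (Suc s) * b s * real (t choose Suc s))"
      unfolding step by (simp only: sum_subtractf[symmetric]) (simp add: algebra_simps)
    also have "(\<Sum>s\<le>card K. (real j - real s) * b s * real (t choose s))
        = (\<Sum>s\<le>Suc (card K). (if s \<le> card K then (real j - real s) * b s else 0) * real (t choose s))"
      by simp
    also have "(\<Sum>s\<le>card K. real (Suc s) * b s * real (t choose Suc s))
        = (\<Sum>s\<le>Suc (card K). (if s = 0 then 0 else real s * b (s - 1)) * real (t choose s))"
      by (simp only: sum.atMost_Suc_shift) simp
    finally show ?thesis
      by (simp only: b'_def left_diff_distrib sum_subtractf)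
  qed
  then show ?case using insert by (intro exI[of _ b']) simp
qed

section \<open>Consistent sets of literals\<close>

definition flip :: "nat \<times> bool \<Rightarrow> nat \<times> bool" where
  "flip l = (fst l, \<not> snd l)"

definition consistent_sets :: "nat \<Rightarrow> nat \<Rightarrow> (nat \<times> bool) set set" where
  "consistent_sets d s = {S. S \<subseteq> {..<d} \<times> UNIV \<and> inj_on fst S \<and> card S = s}"

text \<open>For \<open>s > 0\<close> these sets form a system of representatives for the pairs \<open>{S, flip ` S}\<close> of
  consistent sets.\<close>

definition positive_sets :: "nat \<Rightarrow> nat \<Rightarrow> (nat \<times> bool) set set" where
  "positive_sets d s = {S \<in> consistent_sets d s. (Min (fst ` S), True) \<in> S}"

lemma flip_flip [simp]: "flip (flip l) = l"
  by (simp add: flip_def)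

lemma flip_Pair [simp]: "flip (i, b) = (i, \<not> b)"
  by (simp add: flip_def)

lemma fst_flip [simp]: "fst (flip l) = fst l"
  by (simp add: flip_def)

lemma flip_image_image [simp]: "flip ` flip ` S = S"
  by (simp add: image_image)

lemma fst_image_flip_image [simp]: "fst ` flip ` S = fst ` S"
  by (simp add: image_image)

lemma inj_flip: "inj flip"
  by (metis flip_flip injI)

lemma mem_flip_image_iff: "l \<in> flip ` S \<longleftrightarrow> flip l \<in> S"
  by (metis flip_flip image_iff)

lemma flip_image_subset_iff: "flip ` S \<subseteq> W \<longleftrightarrow> S \<subseteq> flip ` W"
  by (auto simp: mem_flip_image_iff)

lemma finite_consistent_sets: "finite (consistent_sets d s)"
  by (rule finite_subset[of _ "Pow ({..<d} \<times> UNIV)"]) (auto simp: consistent_sets_def)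

lemma finite_positive_sets: "finite (positive_sets d s)"
  by (simp add: positive_sets_def finite_consistent_sets)

lemma flip_image_mem_consistent_sets:
  assumes "S \<in> consistent_sets d s"
  shows "flip ` S \<in> consistent_sets d s"
proof -
  have "inj_on fst (flip ` S)"
    using assms by (auto simp: consistent_sets_def inj_on_def)
  moreover have "flip ` S \<subseteq> {..<d} \<times> UNIV"
    using assms by (auto simp: consistent_sets_def flip_def)
  ultimately show ?thesis
    using assms by (simp add: consistent_sets_def card_image inj_on_subset[OF inj_flip])
qed

lemma mem_consistent_iff:
  assumes "inj_on fst S"
  shows "(i, b) \<in> S \<longleftrightarrow> i \<in> fst ` S \<and> (b \<longleftrightarrow> (i, True) \<in> S)"
proof -
  have "b' = b''" if "(i, b') \<in> S" "(i, b'') \<in> S" for b' b''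
    using inj_onD[OF assms _ that] by simp
  then show ?thesis by (cases b) (force simp: image_iff)+
qed

text \<open>A consistent set amounts to a set of \<open>s\<close> indices together with the subset of those that occur
  in it with \<open>True\<close>.\<close>

lemma card_consistent_sets_le: "card (consistent_sets d s) \<le> 2 ^ s * (d choose s)"
proof -
  define T where "T = {A. A \<subseteq> {..<d} \<and> card A = s}"
  define code where "code S = (fst ` S, {i. (i, True) \<in> S})" for S :: "(nat \<times> bool) set"
  have finT: "finite T"
    by (rule finite_subset[of _ "Pow {..<d}"]) (auto simp: T_def)
  have cardPow: "card (Pow A) = 2 ^ s" and finA: "finite A" if "A \<in> T" for A
    using that finite_subset[of A "{..<d}"] by (auto simp: T_def card_Pow)
  have inj: "inj_on code (consistent_sets d s)"
  proof (rule inj_onI)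
    fix S S' assume S: "S \<in> consistent_sets d s" "S' \<in> consistent_sets d s"
      and eq: "code S = code S'"
    from S have "inj_on fst S" "inj_on fst S'" by (auto simp: consistent_sets_def)
    note mem = this[THEN mem_consistent_iff]
    have "fst ` S = fst ` S'" and "\<And>i. (i, True) \<in> S \<longleftrightarrow> (i, True) \<in> S'"
      using eq by (auto simp: code_def)
    then have "(i, b) \<in> S \<longleftrightarrow> (i, b) \<in> S'" for i b
      unfolding mem(1)[of i b] mem(2)[of i b] by simp
    then show "S = S'" by auto
  qed
  have sub: "code ` consistent_sets d s \<subseteq> Sigma T Pow"
    by (force simp: code_def T_def consistent_sets_def card_image)
  have "card (consistent_sets d s) \<le> card (Sigma T Pow)"
    using inj sub by (rule card_inj_on_le) (use finT finA in auto)
  also have "\<dots> = (\<Sum>A\<in>T. 2 ^ s)"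
    using finT finA cardPow by (subst card_SigmaI) auto
  also have "card T = (d choose s)"
    using n_subsets[of "{..<d}" s] by (simp add: T_def)
  then have "(\<Sum>A\<in>T. 2 ^ s) = 2 ^ s * (d choose s)" by simp
  finally show ?thesis .
qed

lemma positive_or_flip_positive:
  assumes "S \<in> consistent_sets d s" "0 < s"
  shows "S \<in> positive_sets d s \<or> flip ` S \<in> positive_sets d s"
proof -
  have "finite S" "S \<noteq> {}"
    using assms by (auto simp: consistent_sets_def intro: card_ge_0_finite)
  then have "Min (fst ` S) \<in> fst ` S" by (intro Min_in) auto
  then obtain b where "(Min (fst ` S), b) \<in> S" by force
  then show ?thesis
    using assms flip_image_mem_consistent_sets[OF assms(1)]
    by (cases b) (auto simp: positive_sets_def mem_flip_image_iff)
qed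

text \<open>The map \<open>S \<mapsto> flip ` S\<close> sends the positive sets injectively to consistent sets that are not
  positive, so at most half of the consistent sets are positive.\<close>

lemma card_positive_sets_le:
  assumes "0 < s"
  shows "card (positive_sets d s) \<le> 2 ^ (s - 1) * (d choose s)"
proof -
  have disj: "positive_sets d s \<inter> (image flip) ` positive_sets d s = {}"
  proof (rule ccontr)
    assume "\<not> ?thesis"
    then obtain S where S: "S \<in> positive_sets d s" "flip ` S \<in> positive_sets d s" by auto
    then have "(Min (fst ` S), True) \<in> S" "(Min (fst ` S), False) \<in> S" "inj_on fst S"
      by (auto simp: positive_sets_def consistent_sets_def mem_flip_image_iff)
    then show False using inj_onD[of fst S "(Min (fst ` S), True)" "(Min (fst ` S), False)"] by simp
  qed
  have "inj_on (image flip) (positive_sets d s)"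
    by (rule inj_onI) (metis flip_image_image)
  then have "2 * card (positive_sets d s)
      = card (positive_sets d s \<union> (image flip) ` positive_sets d s)"
    using disj by (subst card_Un_disjoint) (auto simp: finite_positive_sets card_image)
  also have "\<dots> \<le> card (consistent_sets d s)"
    by (rule card_mono[OF finite_consistent_sets])
      (auto simp: positive_sets_def flip_image_mem_consistent_sets)
  also have "\<dots> \<le> 2 ^ s * (d choose s)" by (rule card_consistent_sets_le)
  also have "\<dots> = 2 * (2 ^ (s - 1) * (d choose s))"
    using assms by (cases s) auto
  finally show ?thesis by simp
qed

section \<open>The bound for families of consistent sets\<close>

text \<open>This polarizes \<open>|W \<inter> flip ` W'| choose s\<close> into a sum of products of a term in \<open>W\<close> and a term
  in \<open>W'\<close>, as is needed to write the quadratic form through the linear forms \<open>L\<close>.\<close>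

lemma choose_card_Int_flip:
  assumes "W \<subseteq> {..<d} \<times> UNIV" "inj_on fst W"
  shows "card (W \<inter> flip ` W') choose s
    = (\<Sum>S\<in>consistent_sets d s. of_bool (S \<subseteq> W) * of_bool (flip ` S \<subseteq> W'))"
proof -
  have "finite (W \<inter> flip ` W')"
    by (rule finite_subset[of _ "{..<d} \<times> UNIV"]) (use assms in auto)
  from n_subsets[OF this, of s]
  have "card (W \<inter> flip ` W') choose s = card {S. S \<subseteq> W \<inter> flip ` W' \<and> card S = s}" by simp
  also have "{S. S \<subseteq> W \<inter> flip ` W' \<and> card S = s}
      = {S \<in> consistent_sets d s. S \<subseteq> W \<and> flip ` S \<subseteq> W'}"
    using assms inj_on_subset[OF assms(2)] unfolding consistent_sets_def flip_image_subset_iff by auto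
  finally show ?thesis
    by (simp add: finite_consistent_sets Int_def flip: of_bool_conj)
qed

text \<open>The linear conditions are indexed by the empty set and the positive sets. They annihilate the
  quadratic form, which is definite, so there must be at least as many conditions as members of the
  family.\<close>

lemma card_family_le:
  fixes W :: "'v \<Rightarrow> (nat \<times> bool) set"
  assumes "finite V" "finite K" "0 \<notin> K"
    and W: "\<And>v. v \<in> V \<Longrightarrow> W v \<subseteq> {..<d} \<times> UNIV" "\<And>v. v \<in> V \<Longrightarrow> inj_on fst (W v)"
    and K: "\<And>u v. u \<in> V \<Longrightarrow> v \<in> V \<Longrightarrow> u \<noteq> v \<Longrightarrow> card (W u \<inter> flip ` W v) \<in> K"
  shows "card V \<le> 1 + (\<Sum>s = 1..card K. 2 ^ (s - 1) * (d choose s))"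
proof (rule ccontr)
  assume "\<not> ?thesis"
  then have less: "1 + (\<Sum>s = 1..card K. 2 ^ (s - 1) * (d choose s)) < card V" by simp
  define H where "H = insert {} (\<Union>s\<in>{1..card K}. positive_sets d s)"
  have finH: "finite H" by (simp add: H_def finite_positive_sets)
  have "card (\<Union>s\<in>{1..card K}. positive_sets d s) \<le> (\<Sum>s = 1..card K. card (positive_sets d s))"
    by (rule card_UN_le) simp
  also have "\<dots> \<le> (\<Sum>s = 1..card K. 2 ^ (s - 1) * (d choose s))"
    by (intro sum_mono card_positive_sets_le) simp
  finally have "card H < card V"
    using less by (simp add: H_def card_insert_if finite_positive_sets)
  from exists_nontrivial_solution[OF finH \<open>finite V\<close> this,
      of "\<lambda>S v. of_bool (S \<subseteq> W v) :: real"]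
  obtain c :: "'v \<Rightarrow> real" where c: "\<exists>v\<in>V. c v \<noteq> 0"
    and cH: "\<And>S. S \<in> H \<Longrightarrow> (\<Sum>v\<in>V. c v * of_bool (S \<subseteq> W v)) = 0" by blast
  define L where "L S = (\<Sum>v\<in>V. c v * of_bool (S \<subseteq> W v))" for S
  obtain b :: "nat \<Rightarrow> real"
    where b: "\<And>t. (\<Prod>j\<in>K. real j - real t) = (\<Sum>s\<le>card K. b s * real (t choose s))"
    using prod_roots_binomial_expansion[OF \<open>finite K\<close>] by blast
  have vanish: "L S * L (flip ` S) = 0" if "S \<in> consistent_sets d s" "s \<le> card K" for S s
  proof (cases "s = 0")
    case True
    have "finite S" using that finite_subset[of S "{..<d} \<times> UNIV"] by (auto simp: consistent_sets_def)
    then have "S = {}" using that True by (simp add: consistent_sets_def)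
    then show ?thesis using cH[of "{}"] by (simp add: H_def L_def)
  next
    case False
    then have "S \<in> H \<or> flip ` S \<in> H"
      using positive_or_flip_positive[OF that(1)] that(2) by (fastforce simp: H_def)
    then show ?thesis using cH by (auto simp: L_def)
  qed
  have diagonal: "(\<Sum>s\<le>card K. b s * real (card (W u \<inter> flip ` W v) choose s))
      = (if u = v then (\<Prod>j\<in>K. real j) else 0)" if "u \<in> V" "v \<in> V" for u v
  proof (cases "u = v")
    case True
    \<comment> \<open>a consistent set shares no literal with its flip\<close>
    have "W v \<inter> flip ` W v = {}"
    proof (rule ccontr)
      assume "\<not> ?thesis"
      then obtain l where "l \<in> W v" "flip l \<in> W v" by (auto simp: mem_flip_image_iff)
      then have "l = flip l" using inj_onD[OF W(2)[OF that(2)], of l "flip l"] by simp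
      then show False by (cases l) simp
    qed
    then show ?thesis using True by (simp flip: b)
  next
    case False
    then show ?thesis using K[OF that] \<open>finite K\<close> by (auto simp flip: b)
  qed
  have "(\<Prod>j\<in>K. real j) * (\<Sum>v\<in>V. c v ^ 2)
      = (\<Sum>u\<in>V. \<Sum>v\<in>V. c u * c v * (if u = v then (\<Prod>j\<in>K. real j) else 0))"
    using \<open>finite V\<close>
    by (simp add: if_distrib[of "(*) _"] sum_distrib_left power2_eq_square mult.commute cong: if_cong)
  also have "\<dots> = (\<Sum>u\<in>V. \<Sum>v\<in>V. \<Sum>s\<le>card K. \<Sum>S\<in>consistent_sets d s.
      b s * ((c u * of_bool (S \<subseteq> W u)) * (c v * of_bool (flip ` S \<subseteq> W v))))"
    by (intro sum.cong refl)
      (simp add: diagonal[symmetric] choose_card_Int_flip[where d = d] W sum_distrib_left mult_ac)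
  also have "\<dots> = (\<Sum>s\<le>card K. \<Sum>S\<in>consistent_sets d s. \<Sum>u\<in>V. \<Sum>v\<in>V.
      b s * ((c u * of_bool (S \<subseteq> W u)) * (c v * of_bool (flip ` S \<subseteq> W v))))"
    by (simp only: sum.swap[of _ V "{..card K}"] sum.swap[of _ V "consistent_sets d s" for s])
  also have "\<dots> = (\<Sum>s\<le>card K. \<Sum>S\<in>consistent_sets d s. b s * (L S * L (flip ` S)))"
    unfolding L_def sum_product by (simp only: sum_distrib_left)
  also have "\<dots> = 0" by (simp add: vanish)
  finally have "(\<Prod>j\<in>K. real j) * (\<Sum>v\<in>V. c v ^ 2) = 0" .
  moreover have "(\<Prod>j\<in>K. real j) \<noteq> 0"
    using \<open>finite K\<close> \<open>0 \<notin> K\<close> by auto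
  ultimately have "\<forall>v\<in>V. c v = 0"
    using \<open>finite V\<close> by (simp add: sum_nonneg_eq_0_iff)
  with c show False by blast
qed

section \<open>Biclique covers of complete graphs\<close>

text \<open>Here the family is the one of the literal sets of the vertices. They are consistent because the
  two classes of a biclique are disjoint.\<close>

theorem coverable_order_le:
  assumes "finite K" "0 \<notin> K" "n \<in> coverable_orders K d"
  shows "n \<le> 1 + (\<Sum>s = 1..card K. 2 ^ (s - 1) * (d choose s))"
proof -
  obtain B where B: "biclique_cover (complete_graph n) d B"
    and type: "\<forall>e \<in> edges (complete_graph n). card {i. i < d \<and> e \<in> biclique_edges (B i)} \<in> K"
    using assms by (auto simp: coverable_orders_def biclique_cover_of_type_def)
  define W where "W v = {(i, b). i < d \<and> v \<in> (if b then fst (B i) else snd (B i))}" for v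
  have disj: "fst (B i) \<inter> snd (B i) = {}" if "i < d" for i
    using B that by (auto simp: biclique_cover_def is_biclique_def)
  have inj: "inj_on fst (W v)" for v
  proof (rule inj_onI)
    fix l l' assume "l \<in> W v" "l' \<in> W v" "fst l = fst l'"
    then show "l = l'"
      using disj[of "fst l"] by (cases l; cases l') (auto simp: W_def split: if_splits)
  qed
  have count: "card (W u \<inter> flip ` W v) \<in> K" if "u < n" "v < n" "u \<noteq> v" for u v
  proof -
    have "fst ` (W u \<inter> flip ` W v) = {i. i < d \<and> {u, v} \<in> biclique_edges (B i)}"
      (is "?A = ?C")
    proof (intro set_eqI)
      fix i
      have "i \<in> ?A \<longleftrightarrow> (\<exists>b. (i, b) \<in> W u \<and> (i, \<not> b) \<in> W v)"
        by (force simp: mem_flip_image_iff image_iff)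
      also have "\<dots> \<longleftrightarrow> i < d \<and> (u \<in> fst (B i) \<and> v \<in> snd (B i) \<or> u \<in> snd (B i) \<and> v \<in> fst (B i))"
        by (auto simp: W_def ex_bool_eq)
      also have "\<dots> \<longleftrightarrow> i \<in> ?C"
        by (auto simp: biclique_edges_def doubleton_eq_iff)
      finally show "i \<in> ?A \<longleftrightarrow> i \<in> ?C" .
    qed
    then have "card (W u \<inter> flip ` W v) = card ?C"
      by (metis card_image inf_le1 inj inj_on_subset)
    moreover have "{u, v} \<in> edges (complete_graph n)"
      using that by (auto simp: complete_graph_def edges_def)
    ultimately show ?thesis using type by simp
  qed
  have "card {..<n} \<le> 1 + (\<Sum>s = 1..card K. 2 ^ (s - 1) * (d choose s))"
    using assms inj count by (intro card_family_le[where W = W]) (auto simp: W_def)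
  then show ?thesis by simp
qed

text \<open>When \<open>k\<close> increases by one, the right-hand side grows by
  \<open>2^(k+1) * (d choose (k+1)) - 2^k * ((d-1) choose k)\<close>, by Pascal's rule. This is at least
  \<open>2^k * (d choose (k+1))\<close>, the growth of the left-hand side.\<close>

lemma half_sum_le_claimed_bound:
  fixes d k :: nat
  assumes "1 \<le> k" "1 \<le> d"
  shows "1 + (\<Sum>s = 1..k. 2 ^ (s - 1) * (d choose s))
    \<le> 2 ^ k * (d choose k) + (\<Sum>i = 1..k - 1. 2 ^ i * ((d - 1) choose (i - 1)))"
  using assms(1)
proof (induction k rule: dec_induct)
  case base
  then show ?case using assms by simp
next
  case (step k)
  obtain e where d: "d = Suc e" using assms by (cases d) auto
  obtain m where k: "k = Suc m" using step by (cases k) auto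
  have "2 ^ k * (e choose k) \<le> 2 ^ k * (d choose Suc k)" by (simp add: d)
  moreover have "2 ^ k * (d choose k) = 2 ^ k * (e choose k) + 2 ^ k * (e choose m)"
    by (simp add: d k algebra_simps)
  moreover have "(\<Sum>i = 1..k. 2 ^ i * ((d - 1) choose (i - 1)))
      = (\<Sum>i = 1..k - 1. 2 ^ i * ((d - 1) choose (i - 1))) + 2 ^ k * (e choose m)"
    by (simp add: d k)
  moreover have "(2::nat) ^ Suc k * (d choose Suc k) = 2 ^ k * (d choose Suc k) + 2 ^ k * (d choose Suc k)"
    by simp
  moreover have "(\<Sum>s = 1..Suc k. 2 ^ (s - 1) * (d choose s))
      = (\<Sum>s = 1..k. 2 ^ (s - 1) * (d choose s)) + 2 ^ k * (d choose Suc k)"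
    by simp
  ultimately show ?case using step.IH unfolding diff_Suc_1 by linarith
qed

theorem theorem1:
  fixes k d :: nat and K :: "nat set"
  assumes "1 \<le> k" and "k \<le> d"
    and "finite K" and "card K = k" and "\<forall>m \<in> K. 0 < m"
  shows "max_order K d \<le> 2 ^ k * (d choose k) + (\<Sum>i = 1..k - 1. 2 ^ i * ((d - 1) choose (i - 1)))"
proof -
  have "max_order K d \<in> coverable_orders K d"
    unfolding max_order_def
    using finite_coverable_orders one_in_coverable_orders[of K d] by (intro Max_in) auto
  then have "max_order K d \<le> 1 + (\<Sum>s = 1..k. 2 ^ (s - 1) * (d choose s))"
    using coverable_order_le[of K "max_order K d" d] assms by auto
  also have "\<dots> \<le> 2 ^ k * (d choose k) + (\<Sum>i = 1..k - 1. 2 ^ i * ((d - 1) choose (i - 1)))"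
    using assms by (intro half_sum_le_claimed_bound) auto
  finally show ?thesis .
qed

end
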